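(* Let $X$ be an infinite $\mathsf{T}_1$ topological space with the Menger property $\mathsf{S}_{fin}(\mathcal{O},\mathcal{O})$. The following are equivalent: (1) $X$ is weakly Rothberger, i.e. $X$ has the property $\mathsf{S}_1(\mathcal{O},\mathcal{D})$. (2) Player ONE has no winning strategy in the game $\mathsf{G}_1^{\omega}(\mathcal{O},\mathcal{D})$ on $X$.
   Context: For a topological space $X$: $\mathcal{O}$ is the collection of all open covers of $X$; $\mathcal{D}$ is the collection of families of open subsets of $X$ whose union is dense in $X$. Let $\mathcal{A},\mathcal{B}$ be collections of families of sets. $\mathsf{S}_1(\mathcal{A},\mathcal{B})$ is the statement: for each sequence $(A_n:n\in\mathbb{N})$ of elements of $\mathcal{A}$ there is a sequence $(B_n:n\in\mathbb{N})$ with $B_n\in A_n$ for each $n$ and $\{B_n:n\in\mathbb{N}\}\in\mathcal{B}$. $\mathsf{S}_{fin}(\mathcal{A},\mathcal{B})$ is the statement: for each sequence $(A_n:n\in\mathbb{N})$ of elements of $\mathcal{A}$ there is a sequence $(B_n:n\in\mathbb{N})$ such that each $B_n$ is a finite subset of $A_n$ and $\bigcup\{B_n:n\in\mathbb{N}\}\in\mathcal{B}$. A space is Menger if it satisfies $\mathsf{S}_{fin}(\mathcal{O},\mathcal{O})$. The game $\mathsf{G}_1^{\omega}(\mathcal{A},\mathcal{B})$: players ONE and TWO play an inning for each $n\in\omega$. In inning $n$ ONE first selects $O_n\in\mathcal{A}$, then TWO responds with $T_n\in O_n$. TWO wins the play $O_0,T_0,\dots,O_n,T_n,\dots$ if $\{T_n:n\in\omega\}\in\mathcal{B}$;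 otherwise ONE wins. A strategy of a player prescribes that player's next move as a function of the opponent's moves so far; it is winning if every play in which the player follows it is won by that player. *)

theory Defs
  imports "HOL-Analysis.T1_Spaces"
begin

definition open_covers :: "'a topology \<Rightarrow> 'a set set set" where
  "open_covers X = {\<U>. (\<forall>U\<in>\<U>. openin X U) \<and> \<Union>\<U> = topspace X}"

definition dense_open_families :: "'a topology \<Rightarrow> 'a set set set" where
  "dense_open_families X = {\<U>. (\<forall>U\<in>\<U>. openin X U) \<and> X closure_of \<Union>\<U> = topspace X}"

definition S1 :: "'b set set \<Rightarrow> 'b set set \<Rightarrow> bool" where
  "S1 \<A> \<B> \<longleftrightarrow>
    (\<forall>A :: nat \<Rightarrow> 'b set. (\<forall>n. A n \<in> \<A>) \<longrightarrow>
      (\<exists>B :: nat \<Rightarrow> 'b. (\<forall>n. B n \<in> A n) \<and> range B \<in> \<B>))"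

definition Sfin :: "'b set set \<Rightarrow> 'b set set \<Rightarrow> bool" where
  "Sfin \<A> \<B> \<longleftrightarrow>
    (\<forall>A :: nat \<Rightarrow> 'b set. (\<forall>n. A n \<in> \<A>) \<longrightarrow>
      (\<exists>B :: nat \<Rightarrow> 'b set. (\<forall>n. finite (B n) \<and> B n \<subseteq> A n) \<and> (\<Union>n. B n) \<in> \<B>))"

definition Menger_space :: "'a topology \<Rightarrow> bool" where
  "Menger_space X \<longleftrightarrow> Sfin (open_covers X) (open_covers X)"

definition weakly_Rothberger_space :: "'a topology \<Rightarrow> bool" where
  "weakly_Rothberger_space X \<longleftrightarrow> S1 (open_covers X) (dense_open_families X)"

definition G1_play :: "'b set set \<Rightarrow> (nat \<Rightarrow> 'b set) \<Rightarrow> (nat \<Rightarrow> 'b) \<Rightarrow> bool" where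
  "G1_play \<A> Os Ts \<longleftrightarrow> (\<forall>n. Os n \<in> \<A> \<and> Ts n \<in> Os n)"

definition G1_TWO_wins :: "'b set set \<Rightarrow> (nat \<Rightarrow> 'b) \<Rightarrow> bool" where
  "G1_TWO_wins \<B> Ts \<longleftrightarrow> range Ts \<in> \<B>"

text \<open>A strategy of ONE maps the list of TWO's previous moves (in order of play) to ONE's
  next move. Its moves must be legal at every position reachable by following it; its
  values on lists that cannot arise in this way are irrelevant.\<close>

definition G1_ONE_strategy :: "'b set set \<Rightarrow> ('b list \<Rightarrow> 'b set) \<Rightarrow> bool" where
  "G1_ONE_strategy \<A> \<sigma> \<longleftrightarrow>
    (\<forall>ts. (\<forall>i<length ts. ts ! i \<in> \<sigma> (take i ts)) \<longrightarrow> \<sigma> ts \<in> \<A>)"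

definition G1_ONE_follows :: "('b list \<Rightarrow> 'b set) \<Rightarrow> (nat \<Rightarrow> 'b set) \<Rightarrow> (nat \<Rightarrow> 'b) \<Rightarrow> bool" where
  "G1_ONE_follows \<sigma> Os Ts \<longleftrightarrow> (\<forall>n. Os n = \<sigma> (map Ts [0..<n]))"

definition G1_ONE_winning_strategy ::
    "'b set set \<Rightarrow> 'b set set \<Rightarrow> ('b list \<Rightarrow> 'b set) \<Rightarrow> bool" where
  "G1_ONE_winning_strategy \<A> \<B> \<sigma> \<longleftrightarrow>
    G1_ONE_strategy \<A> \<sigma> \<and>
    (\<forall>Os Ts. G1_play \<A> Os Ts \<and> G1_ONE_follows \<sigma> Os Ts \<longrightarrow> \<not> G1_TWO_wins \<B> Ts)"

end

theory Submission
  imports Defs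
begin

text \<open>The proof follows Pawlikowski's theorem on the Rothberger game. By the Menger property ONE's
  covers may be taken countable, so a strategy of ONE is a tree of open sets indexed by finite
  sequences of naturals. Hurewicz's argument for the Menger game yields bounds f 0, f 1, ... that
  cut out a finitely branching subtree such that every point x has infinitely many levels n at which
  each node has a child with index at most f n that contains x. Now intersect, for every choice of
  such children along level n, the chosen children: this gives a family V n of open sets, and every
  point lies in infinitely many of the unions of the V n. The selection principle picks one member
  of each V n with dense union, and a member of V n tells TWO how to answer at every node of level
  n at once.\<close>

section \<open>Countable subcovers and finiteness of bounded sequences\<close>

lemma Menger_space_countable_subcover:
  assumes "Menger_space X" "topspace X \<noteq> {}" "\<U> \<in> open_covers X"
  obtains e :: "nat \<Rightarrow> 'a set" where "range e \<subseteq> \<U>" "\<Union>(range e) = topspace X"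
proof -
  obtain B :: "nat \<Rightarrow> 'a set set" where
    B: "\<And>n. finite (B n)" "\<And>n. B n \<subseteq> \<U>" and cov: "(\<Union>n. B n) \<in> open_covers X"
    using assms(1)[unfolded Menger_space_def Sfin_def, rule_format, of "\<lambda>_. \<U>"] assms(3)
    by blast
  have "countable (\<Union>n. B n)"
    using B(1) by (simp add: countable_finite)
  \<comment> \<open>A nonempty carrier is used here: an empty family is not the range of a
    sequence.\<close>
  moreover have "(\<Union>n. B n) \<noteq> {}"
    using cov assms(2) unfolding open_covers_def by fastforce
  ultimately have "range (from_nat_into (\<Union>n. B n)) = (\<Union>n. B n)"
    by (rule range_from_nat_into[rotated])
  with that[of "from_nat_into (\<Union>n. B n)"] B(2) cov show thesis
    by (auto simp: open_covers_def)
qed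

lemma finite_list_all2:
  assumes "\<And>b. finite {a. R a b}"
  shows "finite {s. list_all2 R s b}"
proof (induction b)
  case (Cons k b)
  have "{s. list_all2 R s (k # b)} = (\<lambda>(a, s). a # s) ` ({a. R a k} \<times> {s. list_all2 R s b})"
    by (auto simp: list_all2_Cons2)
  then show ?case
    using Cons assms by simp
qed simp

section \<open>The Menger game\<close>

text \<open>The list \<open>b\<close> is in reverse order: its head is the bound for the deepest level.\<close>

primrec bounded_points ::
  "'a topology \<Rightarrow> (nat list \<Rightarrow> nat \<Rightarrow> 'a set) \<Rightarrow> nat list \<Rightarrow> nat list \<Rightarrow> 'a set" where
  "bounded_points X G t [] = topspace X"
| "bounded_points X G t (k # b) =
    bounded_points X G t b \<inter> (\<Inter>s\<in>{s. list_all2 (<) s (rev b)}. G (t @ s) k)"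

lemma openin_bounded_points:
  assumes "\<And>s k. openin X (G s k)"
  shows "openin X (bounded_points X G t b)"
proof (induction b)
  case (Cons k b)
  have "finite {s. list_all2 (<) s (rev b)}"
    by (rule finite_list_all2) simp
  \<comment> \<open>A bound 0 in \<open>b\<close> makes the index set empty, and the bare
    intersection is then the whole type; hence the factor \<open>topspace X\<close>.\<close>
  then have "openin X (topspace X \<inter> (\<Inter>s\<in>{s. list_all2 (<) s (rev b)}. G (t @ s) k))"
    by (cases "{s. list_all2 (<) s (rev b)} = {}") (auto intro!: openin_Inter openin_Int assms)
  from openin_Int[OF Cons this] show ?case
    using openin_subset[OF Cons] by (simp add: Int_assoc[symmetric] Int_absorb2)
qed simp

lemma finite_common_bound:
  assumes "finite S" "\<And>s. mono (G s :: nat \<Rightarrow> 'a set)" "\<And>s. x \<in> (\<Union>k. G s k)"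
  shows "\<exists>k. \<forall>s\<in>S. x \<in> G s k"
proof -
  have "\<forall>s. \<exists>k. x \<in> G s k"
    using assms(3) by blast
  then obtain h where h: "\<And>s. x \<in> G s (h s)"
    by metis
  have "x \<in> G s (\<Sum>s\<in>S. h s)" if "s \<in> S" for s
  proof -
    have "h s \<le> (\<Sum>s\<in>S. h s)"
      using that assms(1) by (intro member_le_sum) auto
    then show ?thesis
      using h[of s] monoD[OF assms(2)] by blast
  qed
  then show ?thesis by blast
qed

text \<open>Only finitely many \<open>s\<close> lie below the bounds chosen so far, so by
  monotonicity one further bound serves them all.\<close>

lemma bounded_points_cover:
  assumes "\<And>s. mono (G s)" "\<And>s. (\<Union>k. G s k) = topspace X" "x \<in> topspace X"
  shows "\<exists>b. length b = n \<and> x \<in> bounded_points X G t b"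
proof (induction n)
  case (Suc n)
  then obtain b where b: "length b = n" "x \<in> bounded_points X G t b" by blast
  have "finite {s. list_all2 (<) s (rev b)}"
    by (rule finite_list_all2) simp
  then obtain k where "\<forall>s\<in>{s. list_all2 (<) s (rev b)}. x \<in> G (t @ s) k"
    using finite_common_bound[of "{s. list_all2 (<) s (rev b)}" "\<lambda>s. G (t @ s)" x] assms
    by auto
  with b have "length (k # b) = Suc n \<and> x \<in> bounded_points X G t (k # b)" by simp
  then show ?case by blast
qed (use assms(3) in simp)

text \<open>Once \<open>f\<close> is below the earlier bounds, its own continuation is one of the
  \<open>s\<close> in the intersection, so \<open>x\<close> lies in \<open>G\<close> at that node
  with the next bound \<open>k\<close>. Since \<open>x\<close> is missed there with the value of
  \<open>f\<close>, monotonicity forces that value below \<open>k\<close>.\<close>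

lemma bounded_points_dominates:
  assumes mono: "\<And>s. mono (G s)"
    and miss: "\<And>n. N \<le> n \<Longrightarrow> x \<notin> G (map f [0..<n]) (f n)"
    and "x \<in> bounded_points X G (map f [0..<N]) b"
  shows "list_all2 (<) (map f [N..<N + length b]) (rev b)"
  using assms(3)
proof (induction b)
  case (Cons k b)
  have IH: "list_all2 (<) (map f [N..<N + length b]) (rev b)"
    using Cons by simp
  have "map f [0..<N] @ map f [N..<N + length b] = map f [0..<N + length b]"
    by (metis map_append upt_add_eq_append zero_le)
  moreover have "x \<in> G (map f [0..<N] @ map f [N..<N + length b]) k"
    using Cons.prems IH unfolding bounded_points.simps by blast
  ultimately have "x \<in> G (map f [0..<N + length b]) k" by simp
  then have "f (N + length b) < k"
    using miss[of "N + length b"] monoD[OF mono, of k "f (N + length b)"]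
    by (meson le_add1 not_le subsetD)
  then show ?case
    using IH by (simp add: list_all2_appendI)
qed simp

text \<open>The sets \<open>bounded_points X G t b\<close> with \<open>b\<close> of a given length
  cover \<open>X\<close>. A Menger selection keeps finitely many per length, and \<open>K n\<close>
  dominates their heads, the bounds at the deepest level. The offset \<open>c\<close> lets different
  \<open>t\<close> start at different depths.\<close>

lemma Menger_space_bounds:
  assumes "Menger_space X" "\<And>s k. openin X (G s k)"
    "\<And>s. mono (G s)" "\<And>s. (\<Union>k. G s k) = topspace X"
  shows "\<exists>K. \<forall>x\<in>topspace X. \<exists>n b. length b = Suc (c + n) \<and> hd b \<le> K n \<and>
    x \<in> bounded_points X G t b"
proof -
  define A where "A n = {bounded_points X G t b | b. length b = Suc (c + n)}" for n
  have "A n \<in> open_covers X" for n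
  proof -
    have "openin X U" if "U \<in> A n" for U
      using that openin_bounded_points[of X G, OF assms(2)] by (auto simp: A_def)
    moreover have "x \<in> \<Union>(A n)" if "x \<in> topspace X" for x
      using bounded_points_cover[of G X x "Suc (c + n)" t] assms(3,4) that
      unfolding A_def by blast
    ultimately show ?thesis
      by (auto simp: open_covers_def dest: openin_subset)
  qed
  then obtain B where B: "\<And>n. finite (B n)" "\<And>n. B n \<subseteq> A n"
    and cov: "(\<Union>n. B n) \<in> open_covers X"
    using assms(1)[unfolded Menger_space_def Sfin_def, rule_format, of A] by blast
  define \<beta> where
    "\<beta> n U = (SOME b. length b = Suc (c + n) \<and> U = bounded_points X G t b)" for n U
  have \<beta>: "length (\<beta> n U) = Suc (c + n) \<and> U = bounded_points X G t (\<beta> n U)" if "U \<in> A n" for n U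
  proof -
    have "\<exists>b. length b = Suc (c + n) \<and> U = bounded_points X G t b"
      using that unfolding A_def by blast
    from someI_ex[OF this] show ?thesis
      unfolding \<beta>_def .
  qed
  define K where "K n = (\<Sum>U\<in>B n. hd (\<beta> n U))" for n
  have "\<exists>n b. length b = Suc (c + n) \<and> hd b \<le> K n \<and> x \<in> bounded_points X G t b"
    if "x \<in> topspace X" for x
  proof -
    have "x \<in> \<Union>(\<Union>n. B n)"
      using cov that by (simp add: open_covers_def)
    then obtain n U where U: "U \<in> B n" "x \<in> U" by blast
    have "hd (\<beta> n U) \<le> K n"
      unfolding K_def using U(1) B(1)[of n] by (intro member_le_sum[where f = "\<lambda>U. hd (\<beta> n U)"]) simp_all
    moreover have "length (\<beta> n U) = Suc (c + n)" "x \<in> bounded_points X G t (\<beta> n U)"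
      using \<beta>[of U n] U B(2) by auto
    ultimately show ?thesis by blast
  qed
  then show ?thesis by blast
qed

text \<open>A failure of \<open>f\<close> at \<open>x\<close> from level \<open>N\<close> on is witnessed by the initial segment \<open>t\<close> of \<open>f\<close> of
  length \<open>N\<close>: it forces \<open>f\<close> below any bounds for \<open>x\<close> above \<open>t\<close>. There are only countably many \<open>t\<close>, so
  a single \<open>f\<close> can eventually dominate the Menger selections belonging to all of them.\<close>

lemma Menger_space_game:
  fixes G :: "nat list \<Rightarrow> nat \<Rightarrow> 'a set"
  assumes "Menger_space X" "\<And>s k. openin X (G s k)"
    "\<And>s. mono (G s)" "\<And>s. (\<Union>k. G s k) = topspace X"
  shows "\<exists>f. \<forall>x\<in>topspace X. \<forall>N. \<exists>n\<ge>N. x \<in> G (map f [0..<n]) (f n)"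
proof -
  have "\<forall>t. \<exists>K. \<forall>x\<in>topspace X. \<exists>n b. length b = Suc (to_nat t + n) \<and> hd b \<le> K n \<and>
      x \<in> bounded_points X G t b"
    using Menger_space_bounds[of X G, OF assms] by blast
  then obtain K where K: "\<And>t x. x \<in> topspace X \<Longrightarrow>
      \<exists>n b. length b = Suc (to_nat t + n) \<and> hd b \<le> K t n \<and> x \<in> bounded_points X G t b"
    by metis
  \<comment> \<open>The sum is finite because \<open>to_nat\<close> is injective. A list
    \<open>b\<close> of length \<open>Suc (to_nat t + n)\<close> above \<open>t\<close> has its head
    at level \<open>length t + to_nat t + n\<close>, exactly where \<open>t\<close> contributes
    \<open>K t n\<close>.\<close>
  define f where "f m = (\<Sum>t | length t + to_nat t \<le> m. K t (m - (length t + to_nat t)))" for m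
  have fin: "finite {t :: nat list. length t + to_nat t \<le> m}" for m
  proof (rule finite_imageD)
    show "finite (to_nat ` {t :: nat list. length t + to_nat t \<le> m})"
      by (rule finite_subset[of _ "{..m}"]) auto
  qed auto
  have "\<exists>n\<ge>N. x \<in> G (map f [0..<n]) (f n)" if x: "x \<in> topspace X" for x N
  proof (rule ccontr)
    assume "\<not> ?thesis"
    then have miss: "\<And>n. N \<le> n \<Longrightarrow> x \<notin> G (map f [0..<n]) (f n)" by blast
    define t where "t = map f [0..<N]"
    obtain n b where b: "length b = Suc (to_nat t + n)" "hd b \<le> K t n"
        "x \<in> bounded_points X G t b"
      using K[OF x] by blast
    \<comment> \<open>Level \<open>m\<close> is that of the head of \<open>b\<close>: domination
      will give \<open>f m < hd b\<close> there, against
      \<open>hd b \<le> K t n \<le> f m\<close>.\<close>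
    define m where "m = N + to_nat t + n"
    have "length t = N" by (simp add: t_def)
    have "K t (m - (length t + to_nat t)) \<le> f m"
      unfolding f_def
      by (rule member_le_sum[where f = "\<lambda>t. K t (m - (length t + to_nat t))"])
        (use fin in \<open>auto simp: m_def \<open>length t = N\<close>\<close>)
    then have "hd b \<le> f m"
      using b(2) by (simp add: m_def \<open>length t = N\<close>)
    obtain k b' where kb: "b = k # b'" "length b' = to_nat t + n"
      using b(1) by (cases b) auto
    have "list_all2 (<) (map f [N..<N + length b]) (rev b)"
      using bounded_points_dominates[of G N x f X b, OF assms(3) miss] b(3) by (simp add: t_def)
    then have "list_all2 (<) (map f [N..<m] @ [f m]) (rev b' @ [k])"
      using kb by (simp add: m_def add.assoc)
    then have "f m < k"
      using kb by (subst (asm) list_all2_append) (auto simp: m_def)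
    with \<open>hd b \<le> f m\<close> kb show False by simp
  qed
  then show ?thesis by blast
qed

section \<open>Selections from families that cover every point infinitely often\<close>

text \<open>Greedy choice: the \<open>n\<close> earlier values cannot exhaust
  \<open>I n\<close>.\<close>

lemma distinct_representatives:
  fixes I :: "nat \<Rightarrow> 'i set"
  assumes "\<And>n. finite (I n)" "\<And>n. n < card (I n)"
  obtains h where "inj h" "\<And>n. h n \<in> I n"
proof -
  have "\<exists>h. \<forall>n. h n \<in> I n \<and> h n \<notin> h ` {..<n}"
  proof (rule dependent_wellorder_choice)
    fix n and h :: "nat \<Rightarrow> 'i"
    have "card (h ` {..<n}) < card (I n)"
      using assms(2)[of n] card_image_le[of "{..<n}" h] by simp
    then have "\<not> I n \<subseteq> h ` {..<n}"
      by (meson card_mono finite_imageI finite_lessThan not_le)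
    then show "\<exists>i. i \<in> I n \<and> i \<notin> h ` {..<n}" by blast
  next
    fix i n and g h :: "nat \<Rightarrow> 'i"
    assume "\<And>j. j < n \<Longrightarrow> g j = h j"
    then have "g ` {..<n} = h ` {..<n}" by (intro image_cong) auto
    then show "(i \<in> I n \<and> i \<notin> g ` {..<n}) = (i \<in> I n \<and> i \<notin> h ` {..<n})" by simp
  qed
  then obtain h where h: "\<And>n. h n \<in> I n" "\<And>n. h n \<notin> h ` {..<n}" by blast
  have "inj h"
  proof (rule injI)
    fix m n assume "h m = h n"
    then show "m = n"
      using h(2)[of m] h(2)[of n] by (metis imageI lessThan_iff linorder_neqE_nat)
  qed
  with h(1) that show thesis by blast
qed

text \<open>Apply \<open>S1\<close> to the covers by intersections of members of \<open>n + 1\<close> different families: the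
  \<open>n\<close>-th choice then still offers a family which the earlier choices did not use.\<close>

lemma weakly_Rothberger_space_selection:
  assumes "weakly_Rothberger_space X"
    and V_open: "\<And>n U. U \<in> V n \<Longrightarrow> openin X U"
    and V_ne: "\<And>n. V n \<noteq> {}"
    and V_inf: "\<And>x N. x \<in> topspace X \<Longrightarrow> \<exists>n\<ge>N. x \<in> \<Union>(V n)"
  obtains W :: "nat \<Rightarrow> 'a set" where "\<And>n. W n \<in> V n" "range W \<in> dense_open_families X"
proof -
  define A where "A n = {\<Inter>i\<in>I. g i | I g. finite I \<and> card I = Suc n \<and> (\<forall>i\<in>I. g i \<in> V i)}"
    for n
  have "A n \<in> open_covers X" for n
  proof -
    have "openin X U" if U_A: "U \<in> A n" for U
    proof -
      obtain I g where U: "U = (\<Inter>i\<in>I. g i)"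
        and I: "finite I" "card I = Suc n" "\<forall>i\<in>I. g i \<in> V i"
        using U_A unfolding A_def by blast
      have "I \<noteq> {}" using I(2) by auto
      moreover have "openin X (g i)" if "i \<in> I" for i
        using V_open I(3) that by blast
      ultimately show ?thesis
        unfolding U using I(1) by (intro openin_INT2)
    qed
    moreover have "x \<in> \<Union>(A n)" if "x \<in> topspace X" for x
    proof -
      have "infinite {i. x \<in> \<Union>(V i)}"
        using V_inf[OF that] by (simp add: infinite_nat_iff_unbounded_le)
      then obtain I where I: "finite I" "card I = Suc n" "I \<subseteq> {i. x \<in> \<Union>(V i)}"
        using infinite_arbitrarily_large by blast
      have "\<forall>i\<in>I. \<exists>U. U \<in> V i \<and> x \<in> U"
        using I(3) by blast
      then obtain g where "\<forall>i\<in>I. g i \<in> V i \<and> x \<in> g i"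
        by metis
      then have "(\<Inter>i\<in>I. g i) \<in> A n" "x \<in> (\<Inter>i\<in>I. g i)"
        using I unfolding A_def by blast+
      then show ?thesis by blast
    qed
    ultimately show ?thesis
      by (auto simp: open_covers_def dest: openin_subset)
  qed
  then obtain B where B: "\<And>n. B n \<in> A n" and dense: "range B \<in> dense_open_families X"
    using assms(1)[unfolded weakly_Rothberger_space_def S1_def, rule_format, of A] by blast
  have "\<forall>n. \<exists>I g. B n = (\<Inter>i\<in>I. g i) \<and> finite I \<and> card I = Suc n \<and> (\<forall>i\<in>I. g i \<in> V i)"
    using B unfolding A_def mem_Collect_eq ..
  then obtain I g where Ig: "\<And>n. B n = (\<Inter>i\<in>I n. g n i)" "\<And>n. finite (I n)"
      "\<And>n. card (I n) = Suc n" "\<And>n i. i \<in> I n \<Longrightarrow> g n i \<in> V i"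
    by metis
  obtain h where h: "inj h" "\<And>n. h n \<in> I n"
    using distinct_representatives[of I] Ig(2,3) by auto
  \<comment> \<open>\<open>W (h n)\<close> contains \<open>B n\<close>, which already secures
    density; a family with index outside \<open>range h\<close> gets an arbitrary member.\<close>
  define W where "W i = (if i \<in> range h then g (inv h i) i else SOME U. U \<in> V i)" for i
  have W: "W i \<in> V i" for i
    using Ig(4) h V_ne by (auto simp: W_def some_in_eq)
  have "B n \<subseteq> W (h n)" for n
    using Ig(1) h by (auto simp: W_def)
  then have "X closure_of \<Union>(range B) \<subseteq> X closure_of \<Union>(range W)"
    by (intro closure_of_mono) blast
  then have "range W \<in> dense_open_families X"
    using dense W V_open closure_of_subset_topspace[of X "\<Union>(range W)"]
    by (auto simp: dense_open_families_def)
  with W that show thesis by blast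
qed

section \<open>The game\<close>

lemma weakly_Rothberger_space_no_winning_strategy:
  assumes "Menger_space X" "topspace X \<noteq> {}" "weakly_Rothberger_space X"
  shows "\<not> G1_ONE_winning_strategy (open_covers X) (dense_open_families X) \<sigma>"
proof
  assume win: "G1_ONE_winning_strategy (open_covers X) (dense_open_families X) \<sigma>"
  define legal where "legal ts \<longleftrightarrow> (\<forall>i<length ts. ts ! i \<in> \<sigma> (take i ts))" for ts
  have cover: "\<sigma> ts \<in> open_covers X" if "legal ts" for ts
    using win that by (auto simp: G1_ONE_winning_strategy_def G1_ONE_strategy_def legal_def)
  have "\<forall>ts. \<exists>e :: nat \<Rightarrow> _. legal ts \<longrightarrow> range e \<subseteq> \<sigma> ts \<and> \<Union>(range e) = topspace X"
    using Menger_space_countable_subcover[OF assms(1,2) cover] by metis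
  then obtain e :: "'a set list \<Rightarrow> nat \<Rightarrow> 'a set" where
    e: "\<And>ts k. legal ts \<Longrightarrow> e ts k \<in> \<sigma> ts" "\<And>ts. legal ts \<Longrightarrow> \<Union>(range (e ts)) = topspace X"
    by (metis range_subsetD)
  \<comment> \<open>\<open>pos s\<close> lists TWO's answers when the indices in \<open>s\<close>
    are chosen one after another; every such position is legal, so ONE's next move there is a
    cover.\<close>
  define pos where "pos = foldl (\<lambda>ts k. ts @ [e ts k]) []"
  have legal: "legal (pos s)" for s
  proof (induction s rule: rev_induct)
    case (snoc k s)
    then show ?case
      using e(1)[of "pos s" k] by (auto simp: pos_def legal_def nth_append less_Suc_eq)
  qed (simp add: pos_def legal_def)
  define U where "U s = e (pos s)" for s
  have U: "U s k \<in> \<sigma> (pos s)" "openin X (U s k)" "(\<Union>k. U s k) = topspace X" for s k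
    using e[OF legal[of s]] cover[OF legal[of s]] by (simp_all add: U_def open_covers_def)

  define F where "F s = {t. list_all2 (\<le>) t s}" for s :: "nat list"
  have fin_F: "finite (F s)" for s
    unfolding F_def by (rule finite_list_all2) simp
  have F_ne: "F s \<noteq> {}" for s
    unfolding F_def using list_all2_refl[of "(\<le>)" s] by auto
  \<comment> \<open>Intersecting over all nodes below \<open>s\<close> makes one bound work for a
    whole level, although the Menger game result only follows the single branch
    \<open>map f [0..<n]\<close>.\<close>
  define G where "G s k = (\<Inter>t\<in>F s. \<Union>j\<le>k. U t j)" for s k
  have G_open: "openin X (G s k)" for s k
    unfolding G_def using fin_F F_ne U(2) by (intro openin_INT2) auto
  have G_mono: "mono (G s)" for s
    by (rule monoI) (fastforce simp: G_def)
  have G_cover: "(\<Union>k. G s k) = topspace X" for s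
  proof (intro equalityI subsetI)
    fix x assume x: "x \<in> topspace X"
    have "\<exists>k. \<forall>t\<in>F s. x \<in> (\<Union>j\<le>k. U t j)"
    proof (rule finite_common_bound[OF fin_F])
      show "mono (\<lambda>k. \<Union>j\<le>k. U t j)" for t
        by (rule monoI) fastforce
      show "x \<in> (\<Union>k. \<Union>j\<le>k. U t j)" for t
        using x U(3)[of t] by blast
    qed
    then show "x \<in> (\<Union>k. G s k)"
      by (auto simp: G_def)
  qed (use openin_subset[OF G_open] in blast)
  obtain f where f: "\<And>x N. x \<in> topspace X \<Longrightarrow> \<exists>n\<ge>N. x \<in> G (map f [0..<n]) (f n)"
    using Menger_space_game[of X G, OF assms(1) G_open G_mono G_cover] by blast

  define L where "L n = F (map f [0..<n])" for n
  define V where "V n = {\<Inter>t\<in>L n. U t (\<mu> t) | \<mu>. \<forall>t\<in>L n. \<mu> t \<le> f n}" for n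
  obtain W where W: "\<And>n. W n \<in> V n" and dense: "range W \<in> dense_open_families X"
  proof (rule weakly_Rothberger_space_selection[OF assms(3), of V])
    fix n O' assume "O' \<in> V n"
    then show "openin X O'"
      unfolding V_def L_def using fin_F F_ne U(2) by (auto intro!: openin_INT2)
  next
    fix n
    have "(\<Inter>t\<in>L n. U t 0) \<in> V n" by (auto simp: V_def)
    then show "V n \<noteq> {}" by blast
  next
    fix x N assume "x \<in> topspace X"
    then obtain n where n: "n \<ge> N" "x \<in> G (map f [0..<n]) (f n)"
      using f by blast
    then have "\<forall>t\<in>L n. \<exists>j. j \<le> f n \<and> x \<in> U t j"
      by (auto simp: G_def L_def)
    then obtain \<mu> where "\<forall>t\<in>L n. \<mu> t \<le> f n \<and> x \<in> U t (\<mu> t)"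
      by metis
    then have "(\<Inter>t\<in>L n. U t (\<mu> t)) \<in> V n" "x \<in> (\<Inter>t\<in>L n. U t (\<mu> t))"
      by (auto simp: V_def)
    with n(1) show "\<exists>n\<ge>N. x \<in> \<Union>(V n)" by blast
  qed blast
  from W have "\<forall>n. \<exists>\<mu>. W n = (\<Inter>t\<in>L n. U t (\<mu> t)) \<and> (\<forall>t\<in>L n. \<mu> t \<le> f n)"
    by (auto simp: V_def)
  then obtain \<mu> where \<mu>: "\<And>n. W n = (\<Inter>t\<in>L n. U t (\<mu> n t))" "\<And>n t. t \<in> L n \<Longrightarrow> \<mu> n t \<le> f n"
    by metis

  \<comment> \<open>TWO follows at the node \<open>p n\<close> the index that \<open>W n\<close>
    prescribes there. These indices respect the bounds \<open>f n\<close>, so \<open>p n\<close>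
    stays in \<open>L n\<close> and \<open>T n\<close> is one of the sets intersected in
    \<open>W n\<close>.\<close>
  define p where "p = rec_nat [] (\<lambda>n s. s @ [\<mu> n s])"
  have p_simps: "p 0 = []" "p (Suc n) = p n @ [\<mu> n (p n)]" for n
    by (simp_all add: p_def)
  define T where "T n = U (p n) (\<mu> n (p n))" for n
  have p_L: "p n \<in> L n" for n
  proof (induction n)
    case (Suc n)
    then show ?case
      using \<mu>(2)[OF Suc] by (auto simp: L_def F_def p_simps intro!: list_all2_appendI)
  qed (simp add: p_simps L_def F_def)
  have pos_p: "pos (p n) = map T [0..<n]" for n
  proof (induction n)
    case (Suc n)
    have "pos (p (Suc n)) = pos (p n) @ [e (pos (p n)) (\<mu> n (p n))]"
      by (simp add: p_simps pos_def)
    then show ?case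
      by (simp add: Suc T_def U_def)
  qed (simp add: p_simps pos_def)
  have play: "G1_play (open_covers X) (\<lambda>n. \<sigma> (map T [0..<n])) T"
    unfolding G1_play_def
    using U(1)[of "p _"] cover[OF legal[of "p _"]] by (simp add: pos_p T_def)
  have "W n \<subseteq> T n" for n
    using \<mu>(1) p_L by (auto simp: T_def)
  then have "X closure_of \<Union>(range W) \<subseteq> X closure_of \<Union>(range T)"
    by (intro closure_of_mono) blast
  then have "range T \<in> dense_open_families X"
    using dense U(2) closure_of_subset_topspace[of X "\<Union>(range T)"]
    by (auto simp: dense_open_families_def T_def)
  with win play show False
    by (auto simp: G1_ONE_winning_strategy_def G1_ONE_follows_def G1_TWO_wins_def)
qed

text \<open>ONE may ignore TWO and play \<open>A n\<close> in inning \<open>n\<close>; TWO's moves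
  in a play that ONE loses this way are the required selection.\<close>

lemma S1_if_no_winning_strategy:
  fixes \<A> :: "'b set set"
  assumes "\<not> (\<exists>\<sigma>. G1_ONE_winning_strategy \<A> \<B> \<sigma>)"
  shows "S1 \<A> \<B>"
  unfolding S1_def
proof (intro allI impI)
  fix A :: "nat \<Rightarrow> 'b set"
  assume A: "\<forall>n. A n \<in> \<A>"
  then have "G1_ONE_strategy \<A> (\<lambda>ts. A (length ts))"
    by (simp add: G1_ONE_strategy_def)
  then obtain Os Ts where "G1_play \<A> Os Ts" "G1_ONE_follows (\<lambda>ts. A (length ts)) Os Ts"
      "G1_TWO_wins \<B> Ts"
    using assms unfolding G1_ONE_winning_strategy_def by blast
  then show "\<exists>B. (\<forall>n. B n \<in> A n) \<and> range B \<in> \<B>"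
    by (auto simp: G1_play_def G1_ONE_follows_def G1_TWO_wins_def)
qed

theorem theorem10:
  fixes X :: "'a topology"
  assumes "infinite (topspace X)"
    and "t1_space X"
    and "Menger_space X"
  shows "weakly_Rothberger_space X \<longleftrightarrow>
    \<not> (\<exists>\<sigma>. G1_ONE_winning_strategy (open_covers X) (dense_open_families X) \<sigma>)"
proof
  assume "weakly_Rothberger_space X"
  moreover have "topspace X \<noteq> {}"
    using assms(1) by auto
  ultimately show
    "\<not> (\<exists>\<sigma>. G1_ONE_winning_strategy (open_covers X) (dense_open_families X) \<sigma>)"
    using weakly_Rothberger_space_no_winning_strategy[OF assms(3)] by blast
next
  assume "\<not> (\<exists>\<sigma>. G1_ONE_winning_strategy (open_covers X) (dense_open_families X) \<sigma>)"
  then show "weakly_Rothberger_space X"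
    unfolding weakly_Rothberger_space_def by (rule S1_if_no_winning_strategy)
qed

end
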